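(* Let $\mathcal{D}=(\mathcal{P},\mathcal{B},\mathcal{I})$ be a $2$-$(v,k,\lambda)$ design. If $\mathcal{B}_1\subset\mathcal{B}$ is a switching set of $\mathcal{D}$, then the incidence structure $\mathcal{D}_1=(\mathcal{P},\mathcal{B},\mathcal{I}_1)$ obtained from $\mathcal{D}$ by switching with respect to $\mathcal{B}_1$ is also a $2$-$(v,k,\lambda)$ design.
   Context: A $2$-$(v,k,\lambda)$ design is a finite incidence structure $\mathcal{D}=(\mathcal{P},\mathcal{B},\mathcal{I})$, where $\mathcal{P}$ (points) and $\mathcal{B}$ (blocks) are disjoint sets and $\mathcal{I}\subseteq\mathcal{P}\times\mathcal{B}$, such that: (1) $|\mathcal{P}|=v$ and $1<k<v-1$; (2) every block is incident with exactly $k$ points; (3) every two distinct points are together incident with exactly $\lambda$ blocks. (Blocks are abstract elements, so distinct blocks may be incident with the same set of points.) Switching set: a set of blocks $\mathcal{B}_1\subset\mathcal{B}$ is a switching set of $\mathcal{D}$ if there are sets of points $\mathcal{P}_1,\mathcal{P}_2\subset\mathcal{P}$ such that: 1. $(P,B)\notin\mathcal{I}$ for every $(P,B)\in\mathcal{P}_1\times\mathcal{B}_1$; 2. $(P,B)\in\mathcal{I}$ for every $(P,B)\in\mathcal{P}_2\times\mathcal{B}_1$; 3. $|\{B\in\mathcal{B}_1:(P,B)\in\mathcal{I}\}|=|\{B\in\mathcal{B}_1:(P,B)\notin\mathcal{I}\}|$ for every $P\in\mathcal{P}\setminus(\mathcal{P}_1\cup\mathcal{P}_2)$. Switching: given a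 switching set $\mathcal{B}_1$ with associated point sets $\mathcal{P}_1,\mathcal{P}_2$, the incidence structure $\mathcal{D}_1=(\mathcal{P},\mathcal{B},\mathcal{I}_1)$ obtained from $\mathcal{D}$ by switching with respect to $\mathcal{B}_1$ is defined by: 1. $(P,B)\in\mathcal{I}_1\Leftrightarrow(P,B)\in\mathcal{I}$, for $B\in\mathcal{B}\setminus\mathcal{B}_1$, $P\in\mathcal{P}$; 2. $(P,B)\in\mathcal{I}_1\Leftrightarrow(P,B)\in\mathcal{I}$, for $B\in\mathcal{B}_1$, $P\in\mathcal{P}_1\cup\mathcal{P}_2$; 3. $(P,B)\in\mathcal{I}_1\Leftrightarrow(P,B)\notin\mathcal{I}$, for $B\in\mathcal{B}_1$, $P\in\mathcal{P}\setminus(\mathcal{P}_1\cup\mathcal{P}_2)$. *)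

theory Defs
  imports Main
begin

text \<open>
  Points and blocks live in separate types, which renders their disjointness. Blocks are
  abstract elements, so distinct blocks may be incident with the same points.
\<close>

record ('p, 'b) incidence_structure =
  points :: "'p set"
  blocks :: "'b set"
  incidence :: "('p \<times> 'b) set"

definition finite_incidence_structure :: "('p, 'b) incidence_structure \<Rightarrow> bool" where
  "finite_incidence_structure D \<longleftrightarrow>
     finite (points D) \<and> finite (blocks D) \<and> incidence D \<subseteq> points D \<times> blocks D"

definition two_design :: "('p, 'b) incidence_structure \<Rightarrow> nat \<Rightarrow> nat \<Rightarrow> nat \<Rightarrow> bool" where
  "two_design D v k \<Lambda> \<longleftrightarrow>
     finite_incidence_structure D \<and>
     card (points D) = v \<and> 1 < k \<and> k < v - 1 \<and>
     (\<forall>B\<in>blocks D. card {P \<in> points D. (P, B) \<in> incidence D} = k) \<and>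
     (\<forall>P\<in>points D. \<forall>Q\<in>points D. P \<noteq> Q \<longrightarrow>
        card {B \<in> blocks D. (P, B) \<in> incidence D \<and> (Q, B) \<in> incidence D} = \<Lambda>)"

definition associated_point_sets ::
    "('p, 'b) incidence_structure \<Rightarrow> 'b set \<Rightarrow> 'p set \<Rightarrow> 'p set \<Rightarrow> bool" where
  "associated_point_sets D B1 P1 P2 \<longleftrightarrow>
     P1 \<subseteq> points D \<and> P2 \<subseteq> points D \<and>
     (\<forall>P\<in>P1. \<forall>B\<in>B1. (P, B) \<notin> incidence D) \<and>
     (\<forall>P\<in>P2. \<forall>B\<in>B1. (P, B) \<in> incidence D) \<and>
     (\<forall>P\<in>points D - (P1 \<union> P2).
        card {B \<in> B1. (P, B) \<in> incidence D} = card {B \<in> B1. (P, B) \<notin> incidence D})"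

definition switching_set :: "('p, 'b) incidence_structure \<Rightarrow> 'b set \<Rightarrow> bool" where
  "switching_set D B1 \<longleftrightarrow>
     B1 \<subseteq> blocks D \<and> (\<exists>P1 P2. associated_point_sets D B1 P1 P2)"

text \<open>
  The point sets witnessing that \<open>B1\<close> is a switching set need not be unique, so they are
  arguments of the switching operation.
\<close>

definition switch ::
    "('p, 'b) incidence_structure \<Rightarrow> 'b set \<Rightarrow> 'p set \<Rightarrow> 'p set \<Rightarrow> ('p, 'b) incidence_structure"
  where
  "switch D B1 P1 P2 =
     \<lparr> points = points D, blocks = blocks D,
       incidence = {(P, B) \<in> points D \<times> blocks D.
         (B \<in> blocks D - B1 \<and> (P, B) \<in> incidence D) \<or>
         (B \<in> B1 \<and> P \<in> P1 \<union> P2 \<and> (P, B) \<in> incidence D) \<or>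
         (B \<in> B1 \<and> P \<in> points D - (P1 \<union> P2) \<and> (P, B) \<notin> incidence D)} \<rparr>"

end

theory Submission imports Defs
begin

text \<open>
  Switching preserves, for all points \<open>P\<close> and \<open>Q\<close> (equal or not), the number of blocks
  incident with both. Counting flags and pairs of flags on the same block, the block sizes
  \<open>k\<^sub>B\<close> after switching therefore have the same sum and the same sum of squares as before,
  when they were all equal to \<open>k\<close>. Hence \<open>(\<Sum>B. (k\<^sub>B - k)\<^sup>2) = 0\<close>, so all blocks still have size \<open>k\<close>.
\<close>

lemma sum_card_eq_sum_card:
  assumes "finite A" "finite B"
  shows "(\<Sum>b\<in>B. card {a \<in> A. R a b}) = (\<Sum>a\<in>A. card {b \<in> B. R a b})"
  using sum_multicount_gen[OF assms, of R "\<lambda>b. card {a \<in> A. R a b}"] by simp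

text \<open>The square of a block size counts the ordered pairs of points on that block, the
  diagonal \<open>p = q\<close> included. Double counting against \<open>A \<times> A\<close> then
  gives the claim.\<close>

lemma sum_card_squared_eq_sum_card_pairs:
  assumes "finite A" "finite B"
  shows "(\<Sum>b\<in>B. (card {a \<in> A. R a b})\<^sup>2) = (\<Sum>(p, q)\<in>A \<times> A. card {b \<in> B. R p b \<and> R q b})"
proof -
  have "(card {a \<in> A. R a b})\<^sup>2 = card {x \<in> A \<times> A. R (fst x) b \<and> R (snd x) b}" for b
  proof -
    have "{x \<in> A \<times> A. R (fst x) b \<and> R (snd x) b} = {a \<in> A. R a b} \<times> {a \<in> A. R a b}"
      by auto
    then show ?thesis
      by (simp add: card_cartesian_product power2_eq_square)
  qed
  then show ?thesis
    using sum_card_eq_sum_card[of "A \<times> A" B "\<lambda>x b. R (fst x) b \<and> R (snd x) b"] assms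
    by (simp add: case_prod_unfold)
qed

lemma eq_const_if_sums_eq:
  fixes f :: "'a \<Rightarrow> nat"
  assumes "finite A"
    and "sum f A = card A * k"
    and "(\<Sum>a\<in>A. (f a)\<^sup>2) = card A * k\<^sup>2"
    and "a \<in> A"
  shows "f a = k"
proof -
  \<comment> \<open>The deviations \<open>f a - k\<close> may be negative, so the computation moves
    to \<open>int\<close>, where subtraction does not truncate.\<close>
  have s1: "(\<Sum>a\<in>A. int (f a)) = int (card A) * int k"
    using assms(2) by (metis of_nat_mult of_nat_sum)
  have s2: "(\<Sum>a\<in>A. (int (f a))\<^sup>2) = int (card A) * (int k)\<^sup>2"
    using arg_cong[OF assms(3), of int] by simp
  have "(\<Sum>a\<in>A. (int (f a) - int k)\<^sup>2)
      = (\<Sum>a\<in>A. (int (f a))\<^sup>2) - 2 * int k * (\<Sum>a\<in>A. int (f a)) + int (card A) * (int k)\<^sup>2"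
    by (simp add: power2_diff sum.distrib sum_subtractf sum_distrib_left mult_ac)
  also have "\<dots> = 0"
    unfolding s1 s2 by (simp add: power2_eq_square)
  finally have "(\<Sum>a\<in>A. (int (f a) - int k)\<^sup>2) = 0" .
  then have "(int (f a) - int k)\<^sup>2 = 0"
    using assms(1,4) by (simp add: sum_nonneg_eq_0_iff)
  then show ?thesis by simp
qed

text \<open>By inclusion-exclusion the left side is
  \<open>card S - card X - card Y + card (X \<inter> Y)\<close>, and two halves satisfy
  \<open>card X + card Y = card S\<close>.\<close>

lemma card_Int_Diff_halves:
  assumes "finite S" "X \<subseteq> S" "Y \<subseteq> S"
    and "card X = card (S - X)" "card Y = card (S - Y)"
  shows "card ((S - X) \<inter> (S - Y)) = card (X \<inter> Y)"
proof -
  have fin: "finite X" "finite Y"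
    using assms finite_subset by auto
  have "(S - X) \<inter> (S - Y) = S - (X \<union> Y)" by auto
  then have "card ((S - X) \<inter> (S - Y)) = card S - card (X \<union> Y)"
    using fin assms by (simp add: card_Diff_subset)
  moreover have "card X + card Y = card (X \<union> Y) + card (X \<inter> Y)"
    using fin by (rule card_Un_Int)
  \<comment> \<open>This makes the subtraction on \<open>nat\<close> above a genuine one.\<close>
  moreover have "card (X \<union> Y) \<le> card S"
    using assms by (simp add: card_mono)
  moreover have "card S = 2 * card X" "card S = 2 * card Y"
    using assms fin card_mono[of S X] card_mono[of S Y] by (simp_all add: card_Diff_subset)
  ultimately show ?thesis by linarith
qed

text \<open>Blocks outside \<open>B1\<close> keep their incidences, so only the common blocks inside
  \<open>B1\<close> have to be compared. The case \<open>P = Q\<close> is allowed, since the flag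
  count needs it.\<close>

lemma card_common_blocks_switch:
  assumes "finite (blocks D)" "B1 \<subseteq> blocks D"
    and assoc: "associated_point_sets D B1 P1 P2"
    and PQ: "P \<in> points D" "Q \<in> points D"
  shows "card {B \<in> blocks D. (P, B) \<in> incidence (switch D B1 P1 P2) \<and>
                             (Q, B) \<in> incidence (switch D B1 P1 P2)}
       = card {B \<in> blocks D. (P, B) \<in> incidence D \<and> (Q, B) \<in> incidence D}"
proof -
  define X where "X R = {B \<in> B1. (R, B) \<in> incidence D}" for R
  \<comment> \<open>For a point \<open>R\<close> of \<open>D\<close>, this is the set of blocks of
    \<open>B1\<close> through \<open>R\<close> after switching.\<close>
  define X' where "X' R = (if R \<in> P1 \<union> P2 then X R else B1 - X R)" for R
  define C where "C = {B \<in> blocks D - B1. (P, B) \<in> incidence D \<and> (Q, B) \<in> incidence D}"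
  have fin: "finite B1"
    using assms finite_subset by blast
  have sub: "X R \<subseteq> B1" for R
    by (auto simp: X_def)
  have half: "card (X R) = card (B1 - X R)" if "R \<in> points D" "R \<notin> P1 \<union> P2" for R
  proof -
    have "B1 - X R = {B \<in> B1. (R, B) \<notin> incidence D}"
      by (auto simp: X_def)
    then show ?thesis
      using assoc that by (simp add: associated_point_sets_def X_def)
  qed
  have triv: "X R = {} \<or> X R = B1" if "R \<in> P1 \<union> P2" for R
    using assoc that by (auto simp: associated_point_sets_def X_def)
  have absorb: "B1 \<inter> X R = X R" "B1 \<inter> (B1 - X R) = B1 - X R"
    "X R \<inter> B1 = X R" "(B1 - X R) \<inter> B1 = B1 - X R" for R
    using sub[of R] by auto
  have eq: "card (X' P \<inter> X' Q) = card (X P \<inter> X Q)"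
  proof (cases "P \<in> P1 \<union> P2"; cases "Q \<in> P1 \<union> P2")
    assume "P \<notin> P1 \<union> P2" "Q \<notin> P1 \<union> P2"
    then show ?thesis
      using card_Int_Diff_halves[OF fin sub sub half half] PQ by (simp add: X'_def)
  next
    assume h: "P \<in> P1 \<union> P2" "Q \<notin> P1 \<union> P2"
    then have X': "X' P = X P" "X' Q = B1 - X Q" by (auto simp: X'_def)
    \<comment> \<open>Only \<open>Q\<close> is switched. If \<open>X P\<close> is empty, both
      intersections are empty; if it is \<open>B1\<close>, they are \<open>B1 - X Q\<close> and
      \<open>X Q\<close>, which have equal size. The next case is symmetric.\<close>
    show ?thesis
      using triv[OF h(1)] half[OF PQ(2) h(2)] by (elim disjE) (simp_all add: X' absorb)
  next
    assume h: "P \<notin> P1 \<union> P2" "Q \<in> P1 \<union> P2"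
    then have X': "X' P = B1 - X P" "X' Q = X Q" by (auto simp: X'_def)
    show ?thesis
      using triv[OF h(2)] half[OF PQ(1) h(1)] by (elim disjE) (simp_all add: X' absorb)
  qed (simp add: X'_def)
  have old: "{B \<in> blocks D. (P, B) \<in> incidence D \<and> (Q, B) \<in> incidence D} = C \<union> (X P \<inter> X Q)"
    using assms(2) by (auto simp: C_def X_def)
  have new: "{B \<in> blocks D. (P, B) \<in> incidence (switch D B1 P1 P2) \<and>
      (Q, B) \<in> incidence (switch D B1 P1 P2)} = C \<union> (X' P \<inter> X' Q)"
    using assms(2) PQ by (auto simp: C_def X_def X'_def switch_def)
  have disj: "C \<inter> (X P \<inter> X Q) = {}" "C \<inter> (X' P \<inter> X' Q) = {}"
    by (auto simp: C_def X_def X'_def)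
  have "finite C" "finite (X P \<inter> X Q)" "finite (X' P \<inter> X' Q)"
    using assms(1) fin by (simp_all add: C_def X_def X'_def)
  then show ?thesis
    unfolding old new by (simp add: card_Un_disjoint disj eq)
qed

theorem theorem2:
  fixes D :: "('p, 'b) incidence_structure" and v k \<Lambda> :: nat
  assumes "two_design D v k \<Lambda>"
    and "switching_set D B1"
    and "associated_point_sets D B1 P1 P2"
  shows "two_design (switch D B1 P1 P2) v k \<Lambda>"
proof -
  let ?D1 = "switch D B1 P1 P2"
  have fin: "finite (points D)" "finite (blocks D)"
    and size: "\<And>B. B \<in> blocks D \<Longrightarrow> card {P \<in> points D. (P, B) \<in> incidence D} = k"
    using assms(1) by (auto simp: two_design_def finite_incidence_structure_def)
  have "B1 \<subseteq> blocks D"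
    using assms(2) by (simp add: switching_set_def)
  note common = card_common_blocks_switch[OF fin(2) this assms(3)]
  define f where "f B = card {P \<in> points D. (P, B) \<in> incidence ?D1}" for B
  have "sum f (blocks D) = (\<Sum>P\<in>points D. card {B \<in> blocks D. (P, B) \<in> incidence ?D1})"
    unfolding f_def using fin by (rule sum_card_eq_sum_card)
  also have "\<dots> = (\<Sum>P\<in>points D. card {B \<in> blocks D. (P, B) \<in> incidence D})"
    \<comment> \<open>With both points equal, the count of common blocks becomes the number of
      blocks through \<open>P\<close>.\<close>
    using common[of P P for P] by (intro sum.cong) simp_all
  also have "\<dots> = (\<Sum>B\<in>blocks D. card {P \<in> points D. (P, B) \<in> incidence D})"
    using fin by (rule sum_card_eq_sum_card[symmetric])
  also have "\<dots> = card (blocks D) * k"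
    by (simp add: size)
  finally have s1: "sum f (blocks D) = card (blocks D) * k" .
  have "(\<Sum>B\<in>blocks D. (f B)\<^sup>2) = (\<Sum>(P, Q)\<in>points D \<times> points D.
      card {B \<in> blocks D. (P, B) \<in> incidence ?D1 \<and> (Q, B) \<in> incidence ?D1})"
    unfolding f_def using fin by (rule sum_card_squared_eq_sum_card_pairs)
  also have "\<dots> = (\<Sum>(P, Q)\<in>points D \<times> points D.
      card {B \<in> blocks D. (P, B) \<in> incidence D \<and> (Q, B) \<in> incidence D})"
    \<comment> \<open>The pairs range over the diagonal too, where the number of common blocks need
      not be \<open>\<Lambda>\<close>. Invariance under switching is therefore used for each pair
      instead of the value \<open>\<Lambda>\<close>.\<close>
    by (intro sum.cong) (auto simp: common)
  also have "\<dots> = (\<Sum>B\<in>blocks D. (card {P \<in> points D. (P, B) \<in> incidence D})\<^sup>2)"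
    using fin by (rule sum_card_squared_eq_sum_card_pairs[symmetric])
  also have "\<dots> = card (blocks D) * k\<^sup>2"
    by (simp add: size)
  finally have s2: "(\<Sum>B\<in>blocks D. (f B)\<^sup>2) = card (blocks D) * k\<^sup>2" .
  have "card {P \<in> points D. (P, B) \<in> incidence ?D1} = k" if "B \<in> blocks D" for B
    using eq_const_if_sums_eq[OF fin(2) s1 s2 that] by (simp add: f_def)
  moreover have "points ?D1 = points D" "blocks ?D1 = blocks D"
    "incidence ?D1 \<subseteq> points D \<times> blocks D"
    by (auto simp: switch_def)
  ultimately show ?thesis
    using assms(1) common by (simp add: two_design_def finite_incidence_structure_def)
qed

end
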